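(* We have $$I^{3\underline{12}}(x)=I^{3\underline{21}}(x)=1-\frac{1}{B(x)},$$ where $B(x)=\sum_{n\ge0}B_nx^n$ and $B_n$ is the $n$-th Bell number (the number of set partitions of $[n]$).
   Context: For a permutation $\pi=\pi_1\cdots\pi_n$ of $[n]$, let $i_\pi$ be the smallest index $i$ with $\{\pi_1,\dots,\pi_i\}=\{1,\dots,i\}$; $\pi$ is indecomposable if $i_\pi=n$ (the empty permutation is not indecomposable). A permutation $\pi$ contains the vincular pattern $3\underline{12}$ (resp. $3\underline{21}$) if there are indices $j<k<n$ with $\pi_k<\pi_{k+1}<\pi_j$ (resp. $\pi_{k+1}<\pi_k<\pi_j$); otherwise it avoids it. For a pattern $\sigma$, $I^\sigma_n$ is the number of $\sigma$-avoiding indecomposable permutations of $[n]$ and $I^\sigma(x)=\sum_{n\ge1}I^\sigma_nx^n$. *)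

theory Defs
  imports
    "HOL-Computational_Algebra.Formal_Power_Series"
    "HOL-Combinatorics.Permutations"
    "HOL-Library.Disjoint_Sets"
begin

text \<open>A permutation of \<open>[n]\<close> is a function \<open>\<pi>\<close> with \<open>\<pi> permutes {1..n}\<close>;
  its one-line notation is \<open>\<pi> 1, \<dots>, \<pi> n\<close>.\<close>

text \<open>The index \<open>i\<^sub>\<pi>\<close> ranges over nonempty prefixes (\<open>1 \<le> i\<close>). For \<open>n \<ge> 1\<close> and a permutation
  of \<open>[n]\<close>, the index \<open>n\<close> itself always qualifies; for \<open>n = 0\<close> the value is unspecified.\<close>

definition first_prefix_index :: "nat \<Rightarrow> (nat \<Rightarrow> nat) \<Rightarrow> nat" where
  "first_prefix_index n \<pi> = (LEAST i. 1 \<le> i \<and> i \<le> n \<and> \<pi> ` {1..i} = {1..i})"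

definition indecomposable :: "nat \<Rightarrow> (nat \<Rightarrow> nat) \<Rightarrow> bool" where
  "indecomposable n \<pi> \<longleftrightarrow> n \<ge> 1 \<and> first_prefix_index n \<pi> = n"

text \<open>The underlined letters of the patterns \<open>3\<close>-\<open>12\<close> and \<open>3\<close>-\<open>21\<close>, with the last two letters
  underlined, sit in the adjacent positions \<open>k\<close> and \<open>k + 1\<close>.\<close>

definition contains_3_12 :: "nat \<Rightarrow> (nat \<Rightarrow> nat) \<Rightarrow> bool" where
  "contains_3_12 n \<pi> \<longleftrightarrow>
     (\<exists>j k. 1 \<le> j \<and> j < k \<and> k < n \<and> \<pi> k < \<pi> (k + 1) \<and> \<pi> (k + 1) < \<pi> j)"

definition contains_3_21 :: "nat \<Rightarrow> (nat \<Rightarrow> nat) \<Rightarrow> bool" where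
  "contains_3_21 n \<pi> \<longleftrightarrow>
     (\<exists>j k. 1 \<le> j \<and> j < k \<and> k < n \<and> \<pi> (k + 1) < \<pi> k \<and> \<pi> k < \<pi> j)"

text \<open>Below, a pattern is given by its containment predicate \<open>contains\<close>.\<close>

definition indec_avoiding_count :: "(nat \<Rightarrow> (nat \<Rightarrow> nat) \<Rightarrow> bool) \<Rightarrow> nat \<Rightarrow> nat" where
  "indec_avoiding_count contains n =
     card {\<pi>. \<pi> permutes {1..n} \<and> indecomposable n \<pi> \<and> \<not> contains n \<pi>}"

definition indec_avoiding_fps :: "(nat \<Rightarrow> (nat \<Rightarrow> nat) \<Rightarrow> bool) \<Rightarrow> rat fps" where
  "indec_avoiding_fps contains =
     Abs_fps (\<lambda>n. if n \<ge> 1 then of_nat (indec_avoiding_count contains n) else 0)"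

definition Bell :: "nat \<Rightarrow> nat" where
  "Bell n = card {P. partition_on {1..n} P}"

definition Bell_fps :: "rat fps" where
  "Bell_fps = Abs_fps (\<lambda>n. of_nat (Bell n))"

end

theory Submission
  imports Defs "HOL-Combinatorics.Multiset_Permutations"
begin

text \<open>
  Write \<open>A\<close> for the generating function of all avoiders. A permutation avoids \<open>3\<close>-\<open>12\<close>
  (resp. \<open>3\<close>-\<open>21\<close>) iff, cut before each left-to-right maximum, it consists of blocks whose first
  letter is followed by a decreasing (resp. increasing) word. Splitting off the last block, the one
  led by the overall maximum, gives for avoiders the recurrence that splitting off the block of the
  maximum gives for set partitions, so \<open>A = B\<close>. As both patterns are indecomposable, avoidance is
  inherited by and from the summands of a direct sum; splitting off the first indecomposable summand
  yields \<open>A = 1 + I A\<close>.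
\<close>

section \<open>Set partitions\<close>

text \<open>A set partition is determined by the block of \<open>m\<close>, recorded as
  \<open>T\<close> without \<open>m\<close>, and the partition \<open>P\<close> formed by the other
  blocks. The index set has the same shape as in \<open>bij_betw_avoiders\<close>.\<close>

lemma bij_betw_partition_on_block:
  assumes "m \<in> S"
  shows "bij_betw (\<lambda>(T, P). insert (insert m T) P)
           (SIGMA T:Pow (S - {m}). {P. partition_on (S - {m} - T) P}) {P. partition_on S P}"
proof (rule bij_betwI')
  fix x y
  assume x: "x \<in> (SIGMA T:Pow (S - {m}). {P. partition_on (S - {m} - T) P})"
    and y: "y \<in> (SIGMA T:Pow (S - {m}). {P. partition_on (S - {m} - T) P})"
  obtain T P where xe: "x = (T, P)" by fastforce
  obtain U R where ye: "y = (U, R)" by fastforce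
  have P: "\<And>p. p \<in> P \<Longrightarrow> m \<notin> p" and R: "\<And>p. p \<in> R \<Longrightarrow> m \<notin> p"
    and T: "m \<notin> T" and U: "m \<notin> U"
    using x y unfolding xe ye partition_on_def by auto
  have "T = U \<and> P = R" if eq: "insert (insert m T) P = insert (insert m U) R"
  proof
    have "insert m T \<in> insert (insert m U) R" using eq by blast
    then have "insert m T = insert m U" using R by blast
    then show "T = U" using T U by (metis Diff_insert_absorb)
    \<comment> \<open>\<open>m\<close> lies in no block of \<open>P\<close> or \<open>R\<close>, so
      discarding the blocks that contain \<open>m\<close> recovers each of them from the common
      image.\<close>
    have "P = {p \<in> insert (insert m T) P. m \<notin> p}" using P by auto
    also have "\<dots> = {p \<in> insert (insert m U) R. m \<notin> p}" unfolding eq ..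
    also have "\<dots> = R" using R by auto
    finally show "P = R" .
  qed
  then show "((case x of (T, P) \<Rightarrow> insert (insert m T) P) = (case y of (T, P) \<Rightarrow> insert (insert m T) P))
      = (x = y)"
    unfolding xe ye by auto
next
  fix x assume "x \<in> (SIGMA T:Pow (S - {m}). {P. partition_on (S - {m} - T) P})"
  then obtain T P where xe: "x = (T, P)" "T \<subseteq> S - {m}" "partition_on (S - {m} - T) P" by blast
  have "\<Union> P = S - {m} - T" using partition_onD1[OF xe(3)] by simp
  then have "disjnt (insert m T) (\<Union> P)" by (auto simp: disjnt_iff)
  moreover have "S - insert m T = S - {m} - T" by blast
  ultimately have "partition_on S (insert (insert m T) P)"
    using xe assms by (subst partition_on_insert) auto
  then show "(case x of (T, P) \<Rightarrow> insert (insert m T) P) \<in> {P. partition_on S P}"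
    using xe by simp
next
  fix P assume "P \<in> {P. partition_on S P}"
  then have P: "partition_on S P" by simp
  then obtain p where p: "p \<in> P" "m \<in> p" using assms unfolding partition_on_def by blast
  have "disjnt p (\<Union> (P - {p}))"
    using partition_onD2[OF P] p unfolding disjoint_def disjnt_def by blast
  then have "partition_on (S - p) (P - {p})" "p \<subseteq> S"
    using P p partition_on_insert[of p "P - {p}" S] by (simp_all add: insert_absorb)
  moreover have "S - {m} - (p - {m}) = S - p" using p by blast
  ultimately have "(p - {m}, P - {p}) \<in> (SIGMA T:Pow (S - {m}). {P. partition_on (S - {m} - T) P})"
    by auto
  moreover have "P = insert (insert m (p - {m})) (P - {p})"
    using p by (simp add: insert_absorb)
  ultimately show "\<exists>x\<in>SIGMA T:Pow (S - {m}). {P. partition_on (S - {m} - T) P}.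
      P = (case x of (T, P) \<Rightarrow> insert (insert m T) P)"
    by (intro bexI[of _ "(p - {m}, P - {p})"]) (simp only: prod.case)
qed

section \<open>Avoiding words\<close>

text \<open>\<open>Q\<close> is the order that a consecutive pair must follow when a larger letter precedes it:
  \<open>(>)\<close> for \<open>3\<close>-\<open>12\<close> and \<open>(<)\<close> for \<open>3\<close>-\<open>21\<close>.\<close>

definition avoiding :: "(nat \<Rightarrow> nat \<Rightarrow> bool) \<Rightarrow> nat list \<Rightarrow> bool" where
  "avoiding Q xs \<longleftrightarrow> (\<forall>j k. j < k \<longrightarrow> Suc k < length xs \<longrightarrow> xs ! k < xs ! j \<longrightarrow>
     xs ! Suc k < xs ! j \<longrightarrow> Q (xs ! k) (xs ! Suc k))"

definition avoiders :: "(nat \<Rightarrow> nat \<Rightarrow> bool) \<Rightarrow> nat set \<Rightarrow> nat list set" where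
  "avoiders Q S = {xs \<in> permutations_of_set S. avoiding Q xs}"

text \<open>Serves two cuts: before the maximum of a word, and between the summands of a direct sum.
  The head of \<open>ys\<close> exceeds all of \<open>xs\<close>, so no bad pair straddles the
  cut.\<close>

lemma avoiding_append:
  assumes "\<And>x. x \<in> set xs \<Longrightarrow> ys \<noteq> [] \<Longrightarrow> x < hd ys"
  shows "avoiding Q (xs @ ys) \<longleftrightarrow> avoiding Q xs \<and> avoiding Q ys"
proof (intro iffI conjI)
  assume *: "avoiding Q (xs @ ys)"
  show "avoiding Q xs"
    unfolding avoiding_def
  proof (intro allI impI)
    fix j k assume "j < k" "Suc k < length xs" "xs ! k < xs ! j" "xs ! Suc k < xs ! j"
    then show "Q (xs ! k) (xs ! Suc k)"
      using *[unfolded avoiding_def, rule_format, of j k] by (simp add: nth_append)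
  qed
  show "avoiding Q ys"
    unfolding avoiding_def
  proof (intro allI impI)
    fix j k assume "j < k" "Suc k < length ys" "ys ! k < ys ! j" "ys ! Suc k < ys ! j"
    then show "Q (ys ! k) (ys ! Suc k)"
      using *[unfolded avoiding_def, rule_format, of "length xs + j" "length xs + k"]
      by (simp add: nth_append)
  qed
next
  assume *: "avoiding Q xs \<and> avoiding Q ys"
  show "avoiding Q (xs @ ys)"
    unfolding avoiding_def
  proof (intro allI impI)
    fix j k
    assume jk: "j < k" "Suc k < length (xs @ ys)" "(xs @ ys) ! k < (xs @ ys) ! j"
      "(xs @ ys) ! Suc k < (xs @ ys) ! j"
    show "Q ((xs @ ys) ! k) ((xs @ ys) ! Suc k)"
    proof (cases "Suc k < length xs")
      case True
      then show ?thesis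
        using * jk unfolding avoiding_def by (simp add: nth_append)
    next
      case k: False
      define l where "l = k - length xs"
      define i where "i = j - length xs"
      have hd: "xs ! j < ys ! 0" if "j < length xs"
      proof -
        have "ys \<noteq> []" using jk k by auto
        then show ?thesis using assms[of "xs ! j"] that by (simp add: hd_conv_nth)
      qed
      \<comment> \<open>Subtraction truncates, so this claims \<open>length xs \<le> k\<close>.
        Otherwise the second letter of the pair is the head of \<open>ys\<close>, too large to lie
        below \<open>xs ! j\<close>.\<close>
      have kl: "k = length xs + l"
      proof (rule ccontr)
        assume "k \<noteq> length xs + l"
        then have "Suc k = length xs" using k unfolding l_def by linarith
        then show False using hd jk by (simp add: nth_append)
      qed
      \<comment> \<open>A larger letter in \<open>xs\<close> can be replaced by the head of \<open>ys\<close>, which is larger still.\<close>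
      have "\<exists>i<l. ys ! l < ys ! i \<and> ys ! Suc l < ys ! i"
      proof (cases "j < length xs")
        case True
        then have "ys ! l < ys ! 0" "ys ! Suc l < ys ! 0"
          using hd jk kl by (auto simp: nth_append)
        moreover from this have "0 < l" by (cases l) auto
        ultimately show ?thesis by blast
      next
        case False
        then have "j = length xs + i" unfolding i_def by simp
        then have "i < l" "ys ! l < ys ! i \<and> ys ! Suc l < ys ! i"
          using jk kl by (auto simp: nth_append)
        then show ?thesis by blast
      qed
      then have "Q (ys ! l) (ys ! Suc l)"
        using * jk kl unfolding avoiding_def by auto
      then show ?thesis using kl by (simp add: nth_append)
    qed
  qed
qed

text \<open>The leading \<open>m\<close> is a larger earlier letter for every consecutive pair of
  \<open>ys\<close>, so each such pair is constrained.\<close>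

lemma avoiding_Cons_max:
  assumes "\<And>y. y \<in> set ys \<Longrightarrow> y < m"
  shows "avoiding Q (m # ys) \<longleftrightarrow> successively Q ys"
proof
  assume *: "avoiding Q (m # ys)"
  show "successively Q ys"
    unfolding successively_conv_nth
  proof (intro allI impI)
    fix i assume "Suc i < length ys"
    then show "Q (ys ! i) (ys ! Suc i)"
      using *[unfolded avoiding_def, rule_format, of 0 "Suc i"] assms by simp
  qed
next
  assume "successively Q ys"
  then show "avoiding Q (m # ys)"
    unfolding avoiding_def successively_conv_nth
    by (auto simp: nth_Cons split: nat.splits)
qed

lemma avoiding_append_max:
  assumes "\<And>x. x \<in> set xs \<Longrightarrow> x < m" "\<And>y. y \<in> set ys \<Longrightarrow> y < m"
  shows "avoiding Q (xs @ m # ys) \<longleftrightarrow> avoiding Q xs \<and> successively Q ys"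
  using assms by (subst avoiding_append) (auto simp: avoiding_Cons_max)

lemma set_avoiders: "xs \<in> avoiders Q S \<Longrightarrow> set xs = S"
  by (simp add: avoiders_def permutations_of_set_def)

lemma distinct_avoiders: "xs \<in> avoiders Q S \<Longrightarrow> distinct xs"
  by (simp add: avoiders_def permutations_of_set_def)

lemma length_avoiders: "xs \<in> avoiders Q {1..n} \<Longrightarrow> length xs = n"
  using distinct_card[of xs] set_avoiders[of xs] distinct_avoiders[of xs] by fastforce

lemma finite_avoiders: "finite (avoiders Q S)"
  by (simp add: avoiders_def)

lemma avoiders_empty: "avoiders Q {} = {[]}"
  by (auto simp: avoiders_def avoiding_def)

text \<open>Treats both patterns at once. Translation invariance is for direct sums; uniqueness of
  the \<open>Q\<close>-ordered word makes a block depend only on its leader and the set of its other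
  letters.\<close>

locale word_order =
  fixes Q :: "nat \<Rightarrow> nat \<Rightarrow> bool"
  assumes shift: "Q (i + a) (i + b) \<longleftrightarrow> Q a b"
    and unique_word: "finite T \<Longrightarrow> \<exists>!w. w \<in> permutations_of_set T \<and> successively Q w"
begin

definition word_of :: "nat set \<Rightarrow> nat list" where
  "word_of T = (THE w. w \<in> permutations_of_set T \<and> successively Q w)"

lemma word_of:
  assumes "finite T"
  shows "set (word_of T) = T" "distinct (word_of T)" "successively Q (word_of T)"
  using theI'[OF unique_word[OF assms]]
  unfolding word_of_def permutations_of_set_def by auto

lemma word_of_set: "distinct w \<Longrightarrow> successively Q w \<Longrightarrow> word_of (set w) = w"
  using unique_word[of "set w"] word_of[of "set w"]
  by (auto simp: permutations_of_set_def)

text \<open>Cutting before the maximum \<open>m\<close> leaves an arbitrary avoider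
  \<open>w\<close>, while the letters after \<open>m\<close> form a set \<open>T\<close> whose order
  is forced.\<close>

lemma bij_betw_avoiders:
  assumes S: "finite S" and m: "m \<in> S" "\<And>x. x \<in> S \<Longrightarrow> x \<le> m"
  shows "bij_betw (\<lambda>(T, w). w @ m # word_of T)
           (SIGMA T:Pow (S - {m}). avoiders Q (S - {m} - T)) (avoiders Q S)"
proof (rule bij_betwI')
  fix x y
  assume x: "x \<in> (SIGMA T:Pow (S - {m}). avoiders Q (S - {m} - T))"
    and y: "y \<in> (SIGMA T:Pow (S - {m}). avoiders Q (S - {m} - T))"
  obtain T v where xe: "x = (T, v)" by fastforce
  obtain U w where ye: "y = (U, w)" by fastforce
  have fin: "finite T" "finite U"
    using x y S unfolding xe ye by (auto intro: finite_subset)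
  have "m \<notin> set v" "m \<notin> set w" "m \<notin> set (word_of T)" "m \<notin> set (word_of U)"
    using x y fin unfolding xe ye by (auto dest!: set_avoiders simp: word_of)
  then have "v @ m # word_of T = w @ m # word_of U \<longleftrightarrow> v = w \<and> word_of T = word_of U"
    by (simp add: append_Cons_eq_iff)
  also have "word_of T = word_of U \<longleftrightarrow> T = U"
    using fin word_of(1) by metis
  finally show "((case x of (T, w) \<Rightarrow> w @ m # word_of T) = (case y of (T, w) \<Rightarrow> w @ m # word_of T))
      = (x = y)"
    unfolding xe ye by auto
next
  fix x assume "x \<in> (SIGMA T:Pow (S - {m}). avoiders Q (S - {m} - T))"
  then obtain T w where xe: "x = (T, w)" "T \<subseteq> S - {m}" "w \<in> avoiders Q (S - {m} - T)" by blast
  have fin: "finite T" using xe S by (auto intro: finite_subset)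
  have "set w = S - {m} - T" "distinct w" "avoiding Q w"
    using xe by (auto simp: avoiders_def permutations_of_set_def)
  moreover have lt: "x < m" if "x \<in> S" "x \<noteq> m" for x
    using m(2)[OF that(1)] that(2) by simp
  ultimately have "avoiding Q (w @ m # word_of T)"
    using xe by (subst avoiding_append_max) (auto simp: word_of[OF fin])
  then show "(case x of (T, w) \<Rightarrow> w @ m # word_of T) \<in> avoiders Q S"
    using xe \<open>set w = _\<close> \<open>distinct w\<close> m(1)
    by (auto simp: avoiders_def permutations_of_set_def word_of[OF fin])
next
  fix z assume z: "z \<in> avoiders Q S"
  then have sz: "set z = S" "distinct z" "avoiding Q z"
    by (auto simp: avoiders_def permutations_of_set_def)
  then obtain w t where zw: "z = w @ m # t" using m(1) by (metis split_list)
  have lt: "x < m" if "x \<in> S" "x \<noteq> m" for x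
    using m(2)[OF that(1)] that(2) by simp
  have lt': "x < m" if "x \<in> set w \<union> set t" for x
    using sz that unfolding zw by (intro lt) auto
  have "avoiding Q w" "successively Q t"
    using sz(3) avoiding_append_max[of w m t] lt' unfolding zw by auto
  moreover have "set w = S - {m} - set t" "set t \<subseteq> S - {m}" "distinct w" "distinct t"
    using sz(1,2) unfolding zw by auto
  ultimately show "\<exists>x\<in>SIGMA T:Pow (S - {m}). avoiders Q (S - {m} - T).
      z = (case x of (T, w) \<Rightarrow> w @ m # word_of T)"
    by (intro bexI[of _ "(set t, w)"])
      (auto simp: zw word_of_set avoiders_def permutations_of_set_def)
qed

text \<open>Both counts obey the same recurrence, obtained from the two bijections. The induction
  runs over all finite sets because \<open>S - {m} - T\<close> need not be an initial
  interval.\<close>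

lemma card_avoiders:
  assumes "finite S"
  shows "card (avoiders Q S) = card {P. partition_on S P}"
  using assms
proof (induction S rule: finite_psubset_induct)
  case (psubset S)
  show ?case
  proof (cases "S = {}")
    case True
    then show ?thesis by (simp add: avoiders_empty partition_on_empty)
  next
    case False
    define m where "m = Max S"
    have m: "m \<in> S" "\<And>x. x \<in> S \<Longrightarrow> x \<le> m"
      using False psubset.hyps unfolding m_def by auto
    have fin: "finite {P. partition_on U P}" if "U \<subseteq> S" for U
      using finitely_many_partition_on finite_subset[OF that] psubset.hyps by blast
    have "card (avoiders Q S) = (\<Sum>T\<in>Pow (S - {m}). card (avoiders Q (S - {m} - T)))"
      using bij_betw_same_card[OF bij_betw_avoiders[OF psubset.hyps m]] psubset.hyps
      by (simp add: finite_avoiders)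
    also have "\<dots> = (\<Sum>T\<in>Pow (S - {m}). card {P. partition_on (S - {m} - T) P})"
      by (intro sum.cong refl psubset.IH) (use m in auto)
    also have "\<dots> = card {P. partition_on S P}"
      using bij_betw_same_card[OF bij_betw_partition_on_block[OF m(1)]] psubset.hyps
      by (subst (asm) card_SigmaI) (auto intro!: fin)
    finally show ?thesis .
  qed
qed

section \<open>Direct sums\<close>

text \<open>A form of indecomposability for words that avoids \<open>LEAST\<close>;
  \<open>indecomposable_iff\<close> links it to the original definition.\<close>

definition indec_avoiders :: "nat \<Rightarrow> nat list set" where
  "indec_avoiders n = {w \<in> avoiders Q {1..n}. 1 \<le> n \<and> (\<forall>i\<in>{1..<n}. set (take i w) \<noteq> {1..i})}"

lemma avoiding_map_add: "avoiding Q (map ((+) i) w) \<longleftrightarrow> avoiding Q w"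
  unfolding avoiding_def by (auto simp: shift)

lemma finite_indec_avoiders: "finite (indec_avoiders n)"
  unfolding indec_avoiders_def by (simp add: finite_avoiders)

lemma length_indec_avoiders: "w \<in> indec_avoiders n \<Longrightarrow> length w = n"
  unfolding indec_avoiders_def using length_avoiders by auto

text \<open>The word \<open>v @ map ((+) i) w\<close> is the direct sum of \<open>v\<close> and
  \<open>w\<close>. Its second part lies above its first, so \<open>avoiding_append\<close> applies,
  and shifting preserves avoidance.\<close>

lemma direct_sum_avoiders_iff:
  assumes "set v = {1..i}"
  shows "v @ map ((+) i) w \<in> avoiders Q {1..i + n} \<longleftrightarrow> v \<in> avoiders Q {1..i} \<and> w \<in> avoiders Q {1..n}"
proof -
  have eq: "{1..i} \<union> (+) i ` set w = {1..i + n} \<longleftrightarrow> set w = {1..n}" if "0 \<notin> set w"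
  proof
    assume "set w = {1..n}"
    then show "{1..i} \<union> (+) i ` set w = {1..i + n}" by (auto simp: image_add_atLeastAtMost)
  next
    assume *: "{1..i} \<union> (+) i ` set w = {1..i + n}"
    show "set w = {1..n}"
    proof (rule set_eqI)
      fix x
      have "x \<in> set w \<longleftrightarrow> i + x \<in> {1..i + n}" if "x > 0"
        unfolding *[symmetric] using that by auto
      then show "x \<in> set w \<longleftrightarrow> x \<in> {1..n}"
        using \<open>0 \<notin> set w\<close> by (cases "x = 0") auto
    qed
  qed
  show ?thesis
  \<comment> \<open>The list \<open>w\<close> is arbitrary and may contain 0. If
    \<open>i > 0\<close>, the shifted 0 repeats the letter \<open>i\<close> of \<open>v\<close>, and
    both sides fail.\<close>
  proof (cases "0 \<in> set w \<and> i > 0")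
    case True
    then have "i \<in> set v \<inter> set (map ((+) i) w)" using assms by force
    then have "\<not> distinct (v @ map ((+) i) w)" by auto
    then show ?thesis using True by (auto simp: avoiders_def permutations_of_set_def)
  next
    case False
    have "avoiding Q (v @ map ((+) i) w) \<longleftrightarrow> avoiding Q v \<and> avoiding Q w" if "0 \<notin> set w"
    proof (subst avoiding_append)
      fix x assume x: "x \<in> set v" "map ((+) i) w \<noteq> []"
      then have "hd (map ((+) i) w) = i + hd w" "hd w \<in> set w" by (auto simp: hd_map)
      then have "hd w > 0" using that by (auto intro: gr0I)
      moreover have "x \<le> i" using x assms by simp
      ultimately show "x < hd (map ((+) i) w)" using \<open>hd _ = _\<close> by simp
    qed (simp add: avoiding_map_add)
    moreover have "distinct (v @ map ((+) i) w) \<longleftrightarrow> distinct v \<and> distinct w" if "0 \<notin> set w"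
      using assms that by (auto simp: distinct_map image_iff)
    ultimately show ?thesis using False eq assms
      by (auto simp: avoiders_def permutations_of_set_def)
  qed
qed

text \<open>The first summand is the shortest nonempty prefix whose letters form an initial
  interval; minimality makes it indecomposable. The pairs do not carry \<open>i\<close>, so the
  shift is read off as \<open>length v\<close>.\<close>

lemma bij_betw_direct_sum:
  assumes "1 \<le> n"
  shows "bij_betw (\<lambda>(v, w). v @ map ((+) (length v)) w)
           (\<Union>i\<in>{1..n}. indec_avoiders i \<times> avoiders Q {1..n - i}) (avoiders Q {1..n})"
    (is "bij_betw ?f ?D _")
proof (rule bij_betwI')
  \<comment> \<open>If \<open>v\<close> were longer, \<open>v'\<close> would be a proper prefix of
    it filling an initial interval, against the indecomposability of \<open>v\<close>. Used in both
    directions, this makes the cut unique.\<close>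
  have *: "length v \<le> length v'"
    if "v \<in> indec_avoiders i" "v' \<in> indec_avoiders j" "v @ w = v' @ w'" for v v' w w' i j
  proof (rule ccontr)
    assume "\<not> length v \<le> length v'"
    moreover have "take (length v') v = v'"
      using that(3) \<open>\<not> length v \<le> length v'\<close> by (auto simp: append_eq_append_conv2)
    moreover have "set v' = {1..length v'}" "length v' \<ge> 1"
      using that(2) length_indec_avoiders[OF that(2)] by (auto simp: indec_avoiders_def set_avoiders)
    ultimately show False
      using that(1) length_indec_avoiders[OF that(1)] unfolding indec_avoiders_def by force
  qed
  fix x y assume "x \<in> ?D" "y \<in> ?D"
  then obtain v w v' w' i j where e: "x = (v, w)" "y = (v', w')"
    and i: "v \<in> indec_avoiders i" "v' \<in> indec_avoiders j" by blast
  have "v = v' \<and> w = w'" if eq: "v @ map ((+) (length v)) w = v' @ map ((+) (length v')) w'"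
  proof -
    have "length v = length v'"
      using *[OF i eq] *[OF i(2,1) eq[symmetric]] by simp
    then show ?thesis using eq by (simp add: inj_map_eq_map)
  qed
  then show "(?f x = ?f y) = (x = y)" unfolding e by auto
next
  fix x assume "x \<in> ?D"
  then obtain v w i where e: "x = (v, w)" "v \<in> indec_avoiders i" "w \<in> avoiders Q {1..n - i}" "i \<le> n"
    by auto
  then have "v \<in> avoiders Q {1..i}" "length v = i"
    by (auto simp: indec_avoiders_def length_avoiders)
  then show "?f x \<in> avoiders Q {1..n}"
    using direct_sum_avoiders_iff[of v i w "n - i"] e by (simp add: set_avoiders)
next
  fix z assume z: "z \<in> avoiders Q {1..n}"
  note lz = length_avoiders[OF z]
  define P where "P i \<longleftrightarrow> 1 \<le> i \<and> set (take i z) = {1..i}" for i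
  define i where "i = (LEAST i. P i)"
  have Pn: "P n" unfolding P_def using assms lz z by (simp add: set_avoiders)
  have Pi: "P i" unfolding i_def by (rule LeastI[of P n, OF Pn])
  have least: "i \<le> k" if "P k" for k unfolding i_def by (rule Least_le[of P k, OF that])
  have "i \<le> n" by (rule least[OF Pn])
  define v where "v = take i z"
  define w where "w = map (\<lambda>x. x - i) (drop i z)"
  have sv: "set v = {1..i}" and lv: "length v = i"
    using Pi lz \<open>i \<le> n\<close> unfolding P_def v_def by auto
  \<comment> \<open>This makes the truncated subtraction in \<open>w\<close> exact, so adding
    \<open>i\<close> restores \<open>drop i z\<close>.\<close>
  have "x \<ge> i" if "x \<in> set (drop i z)" for x
  proof -
    have "x \<notin> set v" unfolding v_def
      using that set_take_disj_set_drop_if_distinct[OF distinct_avoiders[OF z], of i i] by blast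
    moreover have "x \<ge> 1" using that in_set_dropD[OF that] set_avoiders[OF z] by auto
    ultimately show ?thesis unfolding sv by auto
  qed
  then have "map ((+) i) w = drop i z"
    unfolding w_def by (auto simp: map_idI)
  then have zz: "z = v @ map ((+) i) w" unfolding v_def by simp
  have "v \<in> avoiders Q {1..i}" "w \<in> avoiders Q {1..n - i}"
    using direct_sum_avoiders_iff[OF sv, of w "n - i"] z \<open>i \<le> n\<close> unfolding zz by auto
  moreover have "set (take k v) \<noteq> {1..k}" if "k \<in> {1..<i}" for k
    using that least[of k] unfolding P_def v_def by (auto simp: min_def)
  ultimately have "v \<in> indec_avoiders i" "w \<in> avoiders Q {1..n - i}"
    using Pi unfolding indec_avoiders_def P_def by auto
  then show "\<exists>x\<in>?D. z = ?f x"
    using zz lv Pi \<open>i \<le> n\<close> unfolding P_def by (intro bexI[of _ "(v, w)"]) auto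
qed

section \<open>The generating function equation\<close>

lemma Bell_recurrence:
  assumes "1 \<le> n"
  shows "Bell n = (\<Sum>i = 1..n. card (indec_avoiders i) * Bell (n - i))"
proof -
  have "Bell n = card (avoiders Q {1..n})" unfolding Bell_def by (simp add: card_avoiders)
  also have "\<dots> = card (\<Union>i\<in>{1..n}. indec_avoiders i \<times> avoiders Q {1..n - i})"
    using bij_betw_same_card[OF bij_betw_direct_sum[OF assms]] by simp
  \<comment> \<open>The products are disjoint because the first word of a pair has length
    \<open>i\<close>.\<close>
  also have "\<dots> = (\<Sum>i = 1..n. card (indec_avoiders i \<times> avoiders Q {1..n - i}))"
    by (rule card_UN_disjoint)
      (auto simp: finite_indec_avoiders finite_avoiders dest!: length_indec_avoiders)
  also have "\<dots> = (\<Sum>i = 1..n. card (indec_avoiders i) * Bell (n - i))"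
    unfolding Bell_def by (simp add: card_cartesian_product card_avoiders)
  finally show ?thesis .
qed

text \<open>The recurrence is the coefficient form of \<open>B = 1 + I B\<close>, that is,
  \<open>B (1 - I) = 1\<close>.\<close>

lemma indec_fps:
  "Abs_fps (\<lambda>n. if n \<ge> 1 then of_nat (card (indec_avoiders n)) else 0) = 1 - 1 / Bell_fps"
    (is "?I = _")
proof -
  have "{P :: nat set set. partition_on {1..0} P} = {{}}" by (auto simp: partition_on_empty)
  then have B0: "Bell 0 = 1" unfolding Bell_def by simp
  have "fps_nth Bell_fps n = fps_nth (1 + ?I * Bell_fps) n" for n
  proof (cases "n = 0")
    case True
    then show ?thesis by (simp add: Bell_fps_def B0)
  next
    case False
    have "fps_nth (?I * Bell_fps) n =
        (\<Sum>i = 0..n. (if i \<ge> 1 then of_nat (card (indec_avoiders i) * Bell (n - i)) else 0))"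
      unfolding fps_mult_nth Bell_fps_def by (intro sum.cong) auto
    also have "\<dots> = (\<Sum>i = 1..n. of_nat (card (indec_avoiders i) * Bell (n - i)))"
      by (intro sum.mono_neutral_cong_right) auto
    also have "\<dots> = of_nat (Bell n)"
      using False by (subst Bell_recurrence) auto
    finally show ?thesis using False by (simp add: Bell_fps_def)
  qed
  then have "Bell_fps = 1 + ?I * Bell_fps" by (rule fps_ext)
  then have "Bell_fps * (1 - ?I) = 1" by (simp add: algebra_simps)
  then have "inverse Bell_fps = 1 - ?I" by (rule fps_inverse_unique)
  \<comment> \<open>Division becomes multiplication by the inverse because the constant term
    \<open>Bell 0 = 1\<close> makes the series a unit.\<close>
  moreover have "1 / Bell_fps = inverse Bell_fps"
    by (subst fps_divide_unit) (simp_all add: Bell_fps_def B0)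
  ultimately show ?thesis by simp
qed

end

section \<open>The increasing and the decreasing order\<close>

interpretation less: word_order "(<)"
proof
  show "\<exists>!w. w \<in> permutations_of_set T \<and> successively (<) w" if "finite T" for T :: "nat set"
  proof (rule ex1I)
    show "sorted_list_of_set T \<in> permutations_of_set T \<and> successively (<) (sorted_list_of_set T)"
      using that by (auto simp: permutations_of_set_def successively_conv_sorted_wrt)
    show "w = sorted_list_of_set T" if "w \<in> permutations_of_set T \<and> successively (<) w" for w
      using that \<open>finite T\<close> by (intro strict_sorted_equal)
        (auto simp: permutations_of_set_def successively_conv_sorted_wrt)
  qed
qed simp

interpretation greater: word_order "(>)"
proof
  show "\<exists>!w. w \<in> permutations_of_set T \<and> successively (>) w" if fin: "finite T" for T :: "nat set"
  proof -
    \<comment> \<open>Reversal exchanges increasing and decreasing words, so existence and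
      uniqueness carry over from \<open>(<)\<close>.\<close>
    obtain w where w: "w \<in> permutations_of_set T" "successively (<) w"
      and u: "\<And>v. v \<in> permutations_of_set T \<Longrightarrow> successively (<) v \<Longrightarrow> v = w"
      using less.unique_word[OF fin] by blast
    show ?thesis
    proof (rule ex1I)
      show "rev w \<in> permutations_of_set T \<and> successively (>) (rev w)"
        using w by (simp add: permutations_of_set_def)
      show "v = rev w" if "v \<in> permutations_of_set T \<and> successively (>) v" for v
        using u[of "rev v"] that by (auto simp: permutations_of_set_def)
    qed
  qed
qed simp

section \<open>One-line notation\<close>

lemma bij_betw_one_line:
  "bij_betw (\<lambda>\<pi>. map \<pi> [1..<Suc n]) {\<pi>. \<pi> permutes {1..n}} (permutations_of_set {1..n})"
    (is "bij_betw ?f ?A ?B")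
proof -
  have inj: "inj_on ?f ?A"
  proof (rule inj_onI)
    fix \<pi> \<rho> assume *: "\<pi> \<in> ?A" "\<rho> \<in> ?A" "?f \<pi> = ?f \<rho>"
    then have "\<pi> x = \<rho> x" if "x \<in> {1..n}" for x using that by (auto simp: map_eq_conv simp del: upt_Suc)
    moreover have "\<pi> x = \<rho> x" if "x \<notin> {1..n}" for x
      using that * by (simp add: permutes_not_in)
    ultimately show "\<pi> = \<rho>" by blast
  qed
  have sub: "?f ` ?A \<subseteq> ?B"
  proof
    fix w assume "w \<in> ?f ` ?A"
    then obtain \<pi> where p: "\<pi> permutes {1..n}" "w = ?f \<pi>" by auto
    have "set [1..<Suc n] = {1..n}" by auto
    then have "set w = {1..n}" "distinct w"
      unfolding p(2) set_map distinct_map using permutes_image[OF p(1)] permutes_inj_on[OF p(1)]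
      by auto
    then show "w \<in> ?B" by (simp add: permutations_of_set_def)
  qed
  \<comment> \<open>Surjectivity by counting: both sides have \<open>n!\<close> elements, and the
    map is injective.\<close>
  have "card (?f ` ?A) = card ?B"
    using card_image[OF inj] by (simp add: card_permutations)
  then have "?f ` ?A = ?B" using sub by (intro card_subset_eq) auto
  with inj show ?thesis by (simp add: bij_betw_def)
qed

text \<open>The index \<open>n\<close> always qualifies for a permutation, so the least one equals
  \<open>n\<close> exactly when no smaller one qualifies.\<close>

lemma indecomposable_iff:
  "indecomposable n \<pi> \<longleftrightarrow>
     1 \<le> n \<and> (\<forall>i\<in>{1..<n}. set (take i (map \<pi> [1..<Suc n])) \<noteq> {1..i})"
  if "\<pi> permutes {1..n}"
proof -
  have take: "set (take i (map \<pi> [1..<Suc n])) = \<pi> ` {1..i}" if "i \<in> {1..<n}" for i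
  proof -
    have "{1..<Suc i} = {1..i}" by auto
    then show ?thesis using that by (simp add: take_map take_upt del: upt_Suc)
  qed
  have "first_prefix_index n \<pi> = n \<longleftrightarrow> (\<forall>i\<in>{1..<n}. \<pi> ` {1..i} \<noteq> {1..i})" if n: "1 \<le> n"
  proof
    assume *: "first_prefix_index n \<pi> = n"
    show "\<forall>i\<in>{1..<n}. \<pi> ` {1..i} \<noteq> {1..i}"
    proof
      fix i assume "i \<in> {1..<n}"
      then show "\<pi> ` {1..i} \<noteq> {1..i}"
        using not_less_Least[of i "\<lambda>i. 1 \<le> i \<and> i \<le> n \<and> \<pi> ` {1..i} = {1..i}"] *
        unfolding first_prefix_index_def by auto
    qed
  next
    assume "\<forall>i\<in>{1..<n}. \<pi> ` {1..i} \<noteq> {1..i}"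
    then show "first_prefix_index n \<pi> = n"
      unfolding first_prefix_index_def using n permutes_image[OF \<open>\<pi> permutes {1..n}\<close>]
      by (intro Least_equality) (auto simp: not_less[symmetric])
  qed
  then show ?thesis unfolding indecomposable_def using take by auto
qed

text \<open>Carries the count from permutations to words; keeping \<open>contains\<close> abstract
  lets both patterns share it.\<close>

lemma (in word_order) indec_avoiding_fps_eq:
  assumes "\<And>n \<pi>. \<pi> permutes {1..n} \<Longrightarrow> contains n \<pi> \<longleftrightarrow> \<not> avoiding Q (map \<pi> [1..<Suc n])"
  shows "indec_avoiding_fps contains = 1 - 1 / Bell_fps"
proof -
  have count: "indec_avoiding_count contains n = card (indec_avoiders n)" for n
  proof -
    have "bij_betw (\<lambda>\<pi>. map \<pi> [1..<Suc n])
        {\<pi> \<in> {\<pi>. \<pi> permutes {1..n}}. indecomposable n \<pi> \<and> \<not> contains n \<pi>}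
        {w \<in> permutations_of_set {1..n}. avoiding Q w \<and> 1 \<le> n \<and>
           (\<forall>i\<in>{1..<n}. set (take i w) \<noteq> {1..i})}"
      by (rule bij_betw_Collect[OF bij_betw_one_line])
        (simp add: assms indecomposable_iff del: upt_Suc, blast)
    from bij_betw_same_card[OF this] show ?thesis
      unfolding indec_avoiding_count_def indec_avoiders_def avoiders_def by simp
  qed
  show ?thesis unfolding indec_avoiding_fps_def count by (rule indec_fps)
qed

text \<open>Lists are indexed from 0 and permutations from 1, hence the instances
  \<open>j - 1\<close>, \<open>k - 1\<close> and \<open>Suc j\<close>, \<open>Suc k\<close>.\<close>

lemma avoiding_one_line:
  "avoiding Q (map \<pi> [1..<Suc n]) \<longleftrightarrow>
     (\<forall>j k. 1 \<le> j \<longrightarrow> j < k \<longrightarrow> k < n \<longrightarrow> \<pi> k < \<pi> j \<longrightarrow> \<pi> (k + 1) < \<pi> j \<longrightarrow> Q (\<pi> k) (\<pi> (k + 1)))"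
  (is "_ \<longleftrightarrow> ?R")
proof
  assume *: "avoiding Q (map \<pi> [1..<Suc n])"
  show ?R
  proof (intro allI impI)
    fix j k assume "1 \<le> j" "j < k" "k < n" "\<pi> k < \<pi> j" "\<pi> (k + 1) < \<pi> j"
    then show "Q (\<pi> k) (\<pi> (k + 1))"
      using *[unfolded avoiding_def, rule_format, of "j - 1" "k - 1"] by (simp del: upt_Suc)
  qed
next
  assume *: ?R
  show "avoiding Q (map \<pi> [1..<Suc n])"
    unfolding avoiding_def
  proof (intro allI impI)
    fix j k assume "j < k" "Suc k < length (map \<pi> [1..<Suc n])"
      "map \<pi> [1..<Suc n] ! k < map \<pi> [1..<Suc n] ! j"
      "map \<pi> [1..<Suc n] ! Suc k < map \<pi> [1..<Suc n] ! j"
    then show "Q (map \<pi> [1..<Suc n] ! k) (map \<pi> [1..<Suc n] ! Suc k)"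
      using *[rule_format, of "Suc j" "Suc k"] by (simp del: upt_Suc)
  qed
qed

text \<open>By injectivity adjacent letters differ, so a pair that is not a descent is an ascent;
  this turns the failure of \<open>Q\<close> into the pattern.\<close>

lemma contains_3_12_iff:
  assumes "\<pi> permutes {1..n}"
  shows "contains_3_12 n \<pi> \<longleftrightarrow> \<not> avoiding (>) (map \<pi> [1..<Suc n])"
proof -
  have "\<pi> k < \<pi> (k + 1) \<and> \<pi> (k + 1) < \<pi> j \<longleftrightarrow>
      \<pi> k < \<pi> j \<and> \<pi> (k + 1) < \<pi> j \<and> \<not> \<pi> k > \<pi> (k + 1)" for j k
    using permutes_inj[OF assms, THEN injD, of k "k + 1"] by linarith
  then show ?thesis
    unfolding contains_3_12_def avoiding_one_line by blast
qed

lemma contains_3_21_iff: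
  assumes "\<pi> permutes {1..n}"
  shows "contains_3_21 n \<pi> \<longleftrightarrow> \<not> avoiding (<) (map \<pi> [1..<Suc n])"
proof -
  have "\<pi> (k + 1) < \<pi> k \<and> \<pi> k < \<pi> j \<longleftrightarrow>
      \<pi> k < \<pi> j \<and> \<pi> (k + 1) < \<pi> j \<and> \<not> \<pi> k < \<pi> (k + 1)" for j k
    using permutes_inj[OF assms, THEN injD, of k "k + 1"] by linarith
  then show ?thesis
    unfolding contains_3_21_def avoiding_one_line by blast
qed

theorem theorem4p7:
  shows "indec_avoiding_fps contains_3_12 = 1 - 1 / Bell_fps
       \<and> indec_avoiding_fps contains_3_21 = 1 - 1 / Bell_fps"
  using greater.indec_avoiding_fps_eq[OF contains_3_12_iff]
    less.indec_avoiding_fps_eq[OF contains_3_21_iff]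
  by blast

end
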